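(* There exists an $\alpha$-competitive algorithm for the fractional knapsack problem in the random-order model, where $\alpha=\frac1e\approx\frac{1}{2.71}$.
   Context: Fractional knapsack problem: a knapsack of capacity $C>0$ and items $[n]$, each item $j$ having value $v_j>0$ and size $s_j>0$. A feasible solution is $\mathbf{x}\in[0,1]^n$ with $\sum_j s_jx_j\le C$, with value $v(\mathbf{x})=\sum_j v_jx_j$; let $\tilde{\mathbf{x}}$ denote an optimal feasible solution. Random-order model: the algorithm knows $n$ and $C$, items arrive in rounds $1,\dots,n$ in the order $\pi(1),\dots,\pi(n)$ for a uniformly random permutation $\pi$ of $[n]$; the value and size of an item are revealed upon its arrival, and the algorithm must immediately and irrevocably choose the fraction $x_{\pi(\ell)}\in[0,1]$ of the current item to pack, keeping the solution feasible. An algorithm is $\alpha$-competitive if on every instance its output satisfies $\mathbb{E}[v(\mathbf{x})]\ge(\alpha-o(1))\,v(\tilde{\mathbf{x}})$, with the expectation over $\pi$ (and any internal randomness) and $o(1)$ with respect to $n\to\infty$. *)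

theory Defs
  imports "HOL-Probability.Probability" "HOL-Library.Landau_Symbols"
begin

definition knapsack_instance :: "nat \<Rightarrow> real \<Rightarrow> (nat \<Rightarrow> real) \<Rightarrow> (nat \<Rightarrow> real) \<Rightarrow> bool" where
  "knapsack_instance n C v s \<longleftrightarrow> 0 < C \<and> (\<forall>j\<in>{1..n}. 0 < v j \<and> 0 < s j)"

text \<open>Solutions are functions on \<open>nat\<close>; only their values on the items \<open>{1..n}\<close> matter.\<close>

definition feasible :: "nat \<Rightarrow> real \<Rightarrow> (nat \<Rightarrow> real) \<Rightarrow> (nat \<Rightarrow> real) \<Rightarrow> bool" where
  "feasible n C s x \<longleftrightarrow> (\<forall>j\<in>{1..n}. x j \<in> {0..1}) \<and> (\<Sum>j=1..n. s j * x j) \<le> C"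

definition solution_value :: "nat \<Rightarrow> (nat \<Rightarrow> real) \<Rightarrow> (nat \<Rightarrow> real) \<Rightarrow> real" where
  "solution_value n v x = (\<Sum>j=1..n. v j * x j)"

definition optimal :: "nat \<Rightarrow> real \<Rightarrow> (nat \<Rightarrow> real) \<Rightarrow> (nat \<Rightarrow> real) \<Rightarrow> (nat \<Rightarrow> real) \<Rightarrow> bool" where
  "optimal n C v s x \<longleftrightarrow> feasible n C s x \<and>
     (\<forall>y. feasible n C s y \<longrightarrow> solution_value n v y \<le> solution_value n v x)"

lemma optimal_exists:
  assumes "knapsack_instance n C v s"
  shows "\<exists>x. optimal n C v s x"
proof -
  define K where "K = (PiE UNIV (\<lambda>i. if i \<in> {1..n} then {0..1} else {0}) :: (nat \<Rightarrow> real) set)"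
  define F where "F = K \<inter> {x. (\<Sum>j=1..n. s j * x j) \<le> C}"
  have "compactin (product_topology (\<lambda>_. euclidean) UNIV) K"
    unfolding K_def by (subst compactin_PiE) auto
  then have "compact K"
    by (simp add: euclidean_product_topology)
  moreover have "closed {x :: nat \<Rightarrow> real. (\<Sum>j=1..n. s j * x j) \<le> C}"
    by (intro closed_Collect_le continuous_intros continuous_on_product_coordinates)
  ultimately have "compact F"
    unfolding F_def by (rule compact_Int_closed)
  moreover have "(\<lambda>_. 0) \<in> F"
    using assms by (auto simp: F_def K_def knapsack_instance_def)
  moreover have "continuous_on F (solution_value n v)"
    unfolding solution_value_def
    by (intro continuous_intros continuous_on_subset[OF continuous_on_product_coordinates]) auto
  ultimately obtain x where x: "x \<in> F" "\<forall>y\<in>F. solution_value n v y \<le> solution_value n v x"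
    using continuous_attains_sup[of F "solution_value n v"] by auto
  have "solution_value n v y \<le> solution_value n v x" if "feasible n C s y" for y
  proof -
    let ?y = "\<lambda>i. if i \<in> {1..n} then y i else 0"
    have "(\<Sum>j=1..n. s j * ?y j) = (\<Sum>j=1..n. s j * y j)"
      by (intro sum.cong) auto
    then have "?y \<in> F"
      using that by (simp add: F_def K_def feasible_def PiE_iff)
    then have "solution_value n v ?y \<le> solution_value n v x"
      using x by blast
    then show ?thesis
      by (simp add: solution_value_def)
  qed
  moreover have "feasible n C s x"
    using x by (auto simp: F_def K_def feasible_def PiE_iff split: if_splits)
  ultimately show ?thesis
    unfolding optimal_def by blast
qed

text \<open>
  What is known in round \<open>l\<close>: the values and sizes of the first \<open>l\<close> arriving items, in order of
  arrival. The item labels themselves are not revealed.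
\<close>

definition history :: "(nat \<Rightarrow> real) \<Rightarrow> (nat \<Rightarrow> real) \<Rightarrow> (nat \<Rightarrow> nat) \<Rightarrow> nat \<Rightarrow> (real \<times> real) list" where
  "history v s \<pi> l = map (\<lambda>i. (v (\<pi> i), s (\<pi> i))) [1..<Suc l]"

text \<open>
  A (randomized) online algorithm, given \<open>n\<close> and \<open>C\<close>, draws a random seed from \<open>seed n C\<close> once and
  independently of the arrival order; \<open>A n C r h\<close> is the fraction packed of the item that arrived
  last in the history \<open>h\<close>, under the seed \<open>r\<close>. Earlier fractions are determined by \<open>r\<close> and the
  prefixes of \<open>h\<close>, so they need not be passed on. A deterministic algorithm ignores \<open>r\<close>.
\<close>

type_synonym 'r seed_dist = "nat \<Rightarrow> real \<Rightarrow> 'r measure"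
type_synonym 'r decision_rule = "nat \<Rightarrow> real \<Rightarrow> 'r \<Rightarrow> (real \<times> real) list \<Rightarrow> real"

text \<open>The round in which item \<open>j\<close> arrives is \<open>inv \<pi> j\<close>.\<close>

definition packing ::
  "'r decision_rule \<Rightarrow> nat \<Rightarrow> real \<Rightarrow> (nat \<Rightarrow> real) \<Rightarrow> (nat \<Rightarrow> real) \<Rightarrow> (nat \<Rightarrow> nat) \<Rightarrow> 'r \<Rightarrow> nat \<Rightarrow> real" where
  "packing A n C v s \<pi> r j = A n C r (history v s \<pi> (inv \<pi> j))"

text \<open>
  Since sizes are positive, feasibility of the final packing implies feasibility after every round.
\<close>

definition online_algorithm :: "'r seed_dist \<Rightarrow> 'r decision_rule \<Rightarrow> bool" where
  "online_algorithm seed A \<longleftrightarrow>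
     (\<forall>n C. prob_space (seed n C)) \<and>
     (\<forall>n C h. (\<lambda>r. A n C r h) \<in> borel_measurable (seed n C)) \<and>
     (\<forall>n C v s \<pi> r. knapsack_instance n C v s \<longrightarrow> \<pi> permutes {1..n} \<longrightarrow> r \<in> space (seed n C) \<longrightarrow>
        feasible n C s (packing A n C v s \<pi> r))"

definition expected_value ::
  "'r seed_dist \<Rightarrow> 'r decision_rule \<Rightarrow> nat \<Rightarrow> real \<Rightarrow> (nat \<Rightarrow> real) \<Rightarrow> (nat \<Rightarrow> real) \<Rightarrow> real" where
  "expected_value seed A n C v s =
     measure_pmf.expectation (pmf_of_set {\<pi>. \<pi> permutes {1..n}})
       (\<lambda>\<pi>. LINT r|seed n C. solution_value n v (packing A n C v s \<pi> r))"

text \<open>The error term depends on \<open>n\<close> only: it is uniform over all instances with \<open>n\<close> items.\<close>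

definition competitive :: "real \<Rightarrow> 'r seed_dist \<Rightarrow> 'r decision_rule \<Rightarrow> bool" where
  "competitive \<alpha> seed A \<longleftrightarrow>
     (\<exists>\<epsilon> :: nat \<Rightarrow> real. \<epsilon> \<in> o(\<lambda>_. 1) \<and>
       (\<forall>n C v s x. knapsack_instance n C v s \<longrightarrow> optimal n C v s x \<longrightarrow>
          expected_value seed A n C v s \<ge> (\<alpha> - \<epsilon> n) * solution_value n v x))"

end

theory Submission imports Defs "HOL-Combinatorics.Multiset_Permutations" "HOL-Real_Asymp.Real_Asymp" begin

text \<open>
  Skip the first \<open>m = \<lceil>n / e\<rceil>\<close> items. Afterwards, in each round solve the fractional problem on
  the items seen so far, giving the current item the fraction \<open>x\<close>, and pack \<open>f x\<close> of it, where
  \<open>f\<close> is the free fraction of the knapsack, which then drops to \<open>f (1 - s x / C)\<close>.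

  Given the set of the first \<open>k\<close> items, the last of them is uniformly distributed, and the
  solution does not depend on their order. So \<open>s x / C\<close> has mean at most \<open>1 / k\<close>, whence by
  backward conditioning \<open>f\<close> has mean at least \<open>m / k\<close> after round \<open>k\<close>, and round \<open>k + 1\<close>
  contributes on average at least \<open>(m / k) (1 / n)\<close> times the optimum. Summation gives
  \<open>(m / n) (1 / m + \<dots> + 1 / (n - 1)) \<ge> (m / n) ln (n / m)\<close>, which tends to \<open>1 / e\<close>.
\<close>

section \<open>Optimal fractional solutions of a multiset of items\<close>

text \<open>Labels are hidden from the algorithm and the arrival order must not influence the
  solution. So fractions are assigned to value-size pairs, and the items form a multiset.\<close>

definition optimal_fractions :: "real \<Rightarrow> (real \<times> real) multiset \<Rightarrow> (real \<times> real \<Rightarrow> real) \<Rightarrow> bool" where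
  "optimal_fractions C M x \<longleftrightarrow> (\<forall>p. x p \<in> {0..1}) \<and> (\<Sum>p\<in>#M. snd p * x p) \<le> C \<and>
     (\<forall>y. (\<forall>p. y p \<in> {0..1}) \<longrightarrow> (\<Sum>p\<in>#M. snd p * y p) \<le> C \<longrightarrow>
        (\<Sum>p\<in>#M. fst p * y p) \<le> (\<Sum>p\<in>#M. fst p * x p))"

lemma continuous_on_sum_mset_coordinates:
  "continuous_on U (\<lambda>x :: 'a \<Rightarrow> real. \<Sum>p\<in>#M. w p * x p)"
  by (induction M)
     (auto intro!: continuous_intros continuous_on_subset[OF continuous_on_product_coordinates])

text \<open>The cube of all fractions is compact by Tychonoff, the size constraint is closed, and
  the linear objective is continuous. The zero solution, feasible as \<open>0 \<le> C\<close>, makes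
  the set nonempty.\<close>

lemma optimal_fractions_exist:
  assumes "0 \<le> C"
  shows "\<exists>x. optimal_fractions C M x"
proof -
  define K where "K = (PiE UNIV (\<lambda>_. {0..1}) :: (real \<times> real \<Rightarrow> real) set)"
  define F where "F = K \<inter> {x. (\<Sum>p\<in>#M. snd p * x p) \<le> C}"
  have "compactin (product_topology (\<lambda>_. euclidean) UNIV) K"
    unfolding K_def by (subst compactin_PiE) auto
  then have "compact K"
    by (simp add: euclidean_product_topology)
  moreover have "closed {x :: real \<times> real \<Rightarrow> real. (\<Sum>p\<in>#M. snd p * x p) \<le> C}"
    by (intro closed_Collect_le continuous_on_sum_mset_coordinates continuous_on_const)
  ultimately have "compact F"
    unfolding F_def by (rule compact_Int_closed)
  moreover have "(\<lambda>_. 0) \<in> F"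
    using assms by (auto simp: F_def K_def)
  ultimately obtain x where "x \<in> F" "\<forall>y\<in>F. (\<Sum>p\<in>#M. fst p * y p) \<le> (\<Sum>p\<in>#M. fst p * x p)"
    using continuous_attains_sup[of F "\<lambda>x. \<Sum>p\<in>#M. fst p * x p"]
      continuous_on_sum_mset_coordinates[of F fst M] by blast
  then show ?thesis
    unfolding optimal_fractions_def F_def K_def by (intro exI[of _ x]) (auto simp: PiE_iff)
qed

text \<open>Ties may be broken arbitrarily as long as the choice depends on the multiset alone: this
  makes it invariant under reordering of the items seen.\<close>

definition opt_fraction :: "real \<Rightarrow> (real \<times> real) multiset \<Rightarrow> real \<times> real \<Rightarrow> real" where
  "opt_fraction C M = (SOME x. optimal_fractions C M x)"

lemma optimal_fractions_opt_fraction: "0 \<le> C \<Longrightarrow> optimal_fractions C M (opt_fraction C M)"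
  unfolding opt_fraction_def using optimal_fractions_exist by (rule someI_ex)

lemma opt_fraction_bounds:
  assumes "0 \<le> C"
  shows "0 \<le> opt_fraction C M p" "opt_fraction C M p \<le> 1"
  using optimal_fractions_opt_fraction[OF assms, of M]
  unfolding optimal_fractions_def atLeastAtMost_iff by blast+

lemma opt_fraction_size_le: "0 \<le> C \<Longrightarrow> (\<Sum>p\<in>#M. snd p * opt_fraction C M p) \<le> C"
  using optimal_fractions_opt_fraction[of C M] by (auto simp: optimal_fractions_def)

lemma sum_mset_image_mset_set:
  fixes h :: "'a \<Rightarrow> real"
  shows "(\<Sum>p\<in>#image_mset \<phi> (mset_set S). h p) = (\<Sum>j\<in>S. h (\<phi> j))"
  by (simp add: sum_unfold_sum_mset multiset.map_comp comp_def)

text \<open>The algorithm cannot tell items of equal value and size apart; averaging over them shows that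
  it loses nothing by treating them alike.\<close>

lemma sum_average_over_fibres:
  fixes y :: "'b \<Rightarrow> real" and w :: "'a \<Rightarrow> real" and \<phi> :: "'b \<Rightarrow> 'a"
  assumes "finite S"
  defines "z \<equiv> \<lambda>p. (\<Sum>i | i \<in> S \<and> \<phi> i = p. y i) / real (card {i\<in>S. \<phi> i = p})"
  shows "(\<Sum>j\<in>S. w (\<phi> j) * z (\<phi> j)) = (\<Sum>j\<in>S. w (\<phi> j) * y j)"
proof -
  have "(\<Sum>j | j \<in> S \<and> \<phi> j = p. w (\<phi> j) * z (\<phi> j)) = (\<Sum>j | j \<in> S \<and> \<phi> j = p. w (\<phi> j) * y j)"
    if "p \<in> \<phi> ` S" for p
  proof -
    have "card {i\<in>S. \<phi> i = p} \<noteq> 0"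
      using assms(1) that by auto
    then have "real (card {i\<in>S. \<phi> i = p}) * z p = (\<Sum>i | i \<in> S \<and> \<phi> i = p. y i)"
      by (simp add: z_def)
    then show ?thesis
      by (simp add: sum_distrib_left[symmetric] mult.left_commute)
  qed
  then show ?thesis
    by (subst (1 2) sum.image_gen[OF assms(1), of _ \<phi>]) (rule sum.cong[OF refl])
qed

text \<open>Averaging \<open>y\<close> over items with the same pair gives a function
  \<open>z\<close> of pairs with the same total size and value, to which the maximality of
  \<open>opt_fraction\<close> applies.\<close>

lemma opt_fraction_optimal:
  fixes v s y :: "'b \<Rightarrow> real"
  assumes "0 \<le> C" "finite S" "\<And>j. j \<in> S \<Longrightarrow> y j \<in> {0..1}" "(\<Sum>j\<in>S. s j * y j) \<le> C"
  defines "\<phi> \<equiv> \<lambda>j. (v j, s j)"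
  shows "(\<Sum>j\<in>S. v j * y j) \<le>
    (\<Sum>j\<in>S. v j * opt_fraction C (image_mset \<phi> (mset_set S)) (\<phi> j))"
proof -
  define z where "z = (\<lambda>p. (\<Sum>i | i \<in> S \<and> \<phi> i = p. y i) / real (card {i\<in>S. \<phi> i = p}))"
  \<comment> \<open>If no item has the pair \<open>p\<close>, division by zero gives
    \<open>z p = 0\<close>.\<close>
  have z: "z p \<in> {0..1}" for p
  proof -
    have "(\<Sum>i | i \<in> S \<and> \<phi> i = p. y i) \<le> real (card {i\<in>S. \<phi> i = p}) * 1"
      using assms(3) by (intro sum_bounded_above) auto
    moreover have "0 \<le> (\<Sum>i | i \<in> S \<and> \<phi> i = p. y i)"
      using assms(3) by (intro sum_nonneg) auto
    ultimately show ?thesis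
      by (auto simp: z_def divide_le_eq_1)
  qed
  have eq: "(\<Sum>j\<in>S. w (\<phi> j) * z (\<phi> j)) = (\<Sum>j\<in>S. w (\<phi> j) * y j)" for w
    unfolding z_def by (rule sum_average_over_fibres[OF assms(2)])
  have "(\<Sum>p\<in>#image_mset \<phi> (mset_set S). snd p * z p) \<le> C"
    using eq[of snd] assms(4) by (simp add: sum_mset_image_mset_set \<phi>_def del: image_mset.compositionality)
  then have "(\<Sum>p\<in>#image_mset \<phi> (mset_set S). fst p * z p) \<le>
      (\<Sum>p\<in>#image_mset \<phi> (mset_set S). fst p * opt_fraction C (image_mset \<phi> (mset_set S)) p)"
    using optimal_fractions_opt_fraction[OF assms(1)] z unfolding optimal_fractions_def by blast
  then show ?thesis
    using eq[of fst] unfolding sum_mset_image_mset_set by (simp add: \<phi>_def)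
qed

section \<open>The packing rule and its capacity bound\<close>

definition free_fraction :: "nat \<Rightarrow> real \<Rightarrow> (real \<times> real) list \<Rightarrow> real" where
  "free_fraction m C h = (\<Prod>k=m..<length h. 1 - snd (h ! k) * opt_fraction C (mset (take (Suc k) h)) (h ! k) / C)"

definition pack_last :: "nat \<Rightarrow> real \<Rightarrow> (real \<times> real) list \<Rightarrow> real" where
  "pack_last m C h = (if length h \<le> m then 0
     else free_fraction m C (butlast h) * opt_fraction C (mset h) (last h))"

text \<open>The weight is a parameter so that \<open>w = fst\<close> gives the total value and
  \<open>w = snd\<close> the total size.\<close>

definition packed :: "(real \<times> real \<Rightarrow> real) \<Rightarrow> nat \<Rightarrow> real \<Rightarrow> (real \<times> real) list \<Rightarrow> real" where
  "packed w m C h = (\<Sum>k<length h. w (h ! k) * pack_last m C (take (Suc k) h))"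

lemma free_fraction_short: "length h \<le> m \<Longrightarrow> free_fraction m C h = 1"
  by (simp add: free_fraction_def)

lemma free_fraction_snoc:
  "m \<le> length h \<Longrightarrow> free_fraction m C (h @ [p]) =
     free_fraction m C h * (1 - snd p * opt_fraction C (mset (h @ [p])) p / C)"
  by (simp add: free_fraction_def nth_append)

lemma packed_snoc: "packed w m C (h @ [p]) = packed w m C h + w p * pack_last m C (h @ [p])"
  by (simp add: packed_def nth_append)

lemma packed_short: "length h \<le> m \<Longrightarrow> packed w m C h = 0"
  by (simp add: packed_def pack_last_def)

lemma sum_mset_image_nonneg:
  fixes f :: "'a \<Rightarrow> real"
  shows "(\<And>q. q \<in># N \<Longrightarrow> 0 \<le> f q) \<Longrightarrow> 0 \<le> (\<Sum>q\<in>#N. f q)"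
  by (induction N) auto

text \<open>By nonnegativity a single summand is at most the size of the whole solution, hence at
  most \<open>C\<close>.\<close>

lemma used_fraction_bounds:
  assumes "0 < C" "\<forall>q\<in>#M. 0 \<le> snd q" "p \<in># M"
  shows "0 \<le> snd p * opt_fraction C M p / C" "snd p * opt_fraction C M p / C \<le> 1"
proof -
  show "0 \<le> snd p * opt_fraction C M p / C"
    using assms opt_fraction_bounds[of C M p] by simp
  have "snd p * opt_fraction C M p \<le> (\<Sum>q\<in>#M. snd q * opt_fraction C M q)"
  proof -
    obtain N where M: "M = add_mset p N"
      using multi_member_split[OF assms(3)] by blast
    have "0 \<le> (\<Sum>q\<in>#N. snd q * opt_fraction C M q)"
      using assms opt_fraction_bounds[of C M] by (intro sum_mset_image_nonneg) (auto simp: M)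
    then show ?thesis by (simp add: M)
  qed
  also have "\<dots> \<le> C"
    using assms(1) by (intro opt_fraction_size_le) simp
  finally show "snd p * opt_fraction C M p / C \<le> 1"
    using assms(1) by simp
qed

lemma free_fraction_bounds:
  assumes "0 < C" "\<forall>q\<in>set h. 0 \<le> snd q"
  shows "0 \<le> free_fraction m C h" "free_fraction m C h \<le> 1"
proof -
  have "0 \<le> snd (h ! k) * opt_fraction C (mset (take (Suc k) h)) (h ! k) / C \<and>
      snd (h ! k) * opt_fraction C (mset (take (Suc k) h)) (h ! k) / C \<le> 1" if "k < length h" for k
    using used_fraction_bounds[OF assms(1), of "mset (take (Suc k) h)" "h ! k"] assms(2) that
    by (auto simp: take_Suc_conv_app_nth dest: in_set_takeD)
  then show "0 \<le> free_fraction m C h" "free_fraction m C h \<le> 1"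
    unfolding free_fraction_def by (auto intro!: prod_nonneg prod_le_1)
qed

lemma pack_last_bounds:
  assumes "0 < C" "\<forall>q\<in>set h. 0 \<le> snd q"
  shows "pack_last m C h \<in> {0..1}"
  using free_fraction_bounds[OF assms(1), of "butlast h" m] assms
    opt_fraction_bounds[of C "mset h" "last h"]
  by (auto simp: pack_last_def in_set_butlastD intro!: mult_le_one)

text \<open>Packing the fraction \<open>f * x\<close> of an item of size \<open>s\<close> lowers the
  free capacity \<open>C * f\<close> to \<open>C * f * (1 - s * x / C)\<close>. Respecting the
  capacity thus reduces to \<open>free_fraction\<close> being nonnegative.\<close>

lemma packed_size:
  assumes "C \<noteq> 0"
  shows "packed snd m C h = C * (1 - free_fraction m C h)"
proof (induction h rule: rev_induct)
  case Nil
  then show ?case by (simp add: packed_def free_fraction_def)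
next
  case (snoc p h)
  show ?case
  proof (cases "m \<le> length h")
    case True
    then show ?thesis
      using assms by (simp add: packed_snoc snoc free_fraction_snoc pack_last_def field_simps)
  next
    case False
    then show ?thesis by (simp add: packed_short free_fraction_short)
  qed
qed

section \<open>Averages over arrival orders\<close>

text \<open>Reversal is a bijection on the orders of a set, so the decomposition by first element
  becomes one by last element.\<close>

lemma sum_permutations_of_set_snoc:
  assumes "finite S" "S \<noteq> {}"
  shows "(\<Sum>xs\<in>permutations_of_set S. F xs) =
    (\<Sum>x\<in>S. \<Sum>xs\<in>permutations_of_set (S - {x}). (F (xs @ [x]) :: real))"
proof -
  have inv: "(\<Sum>xs\<in>permutations_of_set T. G (rev xs)) = (\<Sum>xs\<in>permutations_of_set T. G xs)"
    for T :: "'a set" and G :: "'a list \<Rightarrow> real"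
    by (rule sum.reindex_bij_witness[of _ rev rev]) (auto simp: permutations_of_set_def)
  have "(\<Sum>xs\<in>permutations_of_set S. F xs) = (\<Sum>xs\<in>permutations_of_set S. F (rev xs))"
    by (rule inv[symmetric])
  also have "\<dots> = (\<Sum>x\<in>S. \<Sum>xs\<in>(#) x ` permutations_of_set (S - {x}). F (rev xs))"
    using assms by (subst permutations_of_set_nonempty) (auto intro!: sum.UNION_disjoint)
  also have "\<dots> = (\<Sum>x\<in>S. \<Sum>xs\<in>permutations_of_set (S - {x}). F (rev xs @ [x]))"
    by (simp add: sum.reindex)
  also have "\<dots> = (\<Sum>x\<in>S. \<Sum>xs\<in>permutations_of_set (S - {x}). F (xs @ [x]))"
    by (intro sum.cong[OF refl] inv[of "\<lambda>xs. F (xs @ [_])"])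
  finally show ?thesis .
qed

definition avg_orders :: "'a set \<Rightarrow> ('a list \<Rightarrow> real) \<Rightarrow> real" where
  "avg_orders S F = (\<Sum>xs\<in>permutations_of_set S. F xs) / fact (card S)"

lemma avg_orders_cong:
  "(\<And>xs. xs \<in> permutations_of_set S \<Longrightarrow> F xs = G xs) \<Longrightarrow> avg_orders S F = avg_orders S G"
  by (simp add: avg_orders_def)

lemma avg_orders_const: "finite S \<Longrightarrow> avg_orders S (\<lambda>_. c) = c"
  by (simp add: avg_orders_def)

text \<open>Backward conditioning: the last element of a uniformly random order is uniform on
  \<open>S\<close>, and the elements before it are again in uniformly random order.\<close>

lemma avg_orders_snoc:
  assumes "finite S" "S \<noteq> {}"
  shows "avg_orders S F = (\<Sum>x\<in>S. avg_orders (S - {x}) (\<lambda>xs. F (xs @ [x]))) / card S"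
proof -
  obtain k where k: "card S = Suc k"
    using assms by (metis card_eq_0_iff not0_implies_Suc)
  then have "card (S - {x}) = k" if "x \<in> S" for x
    using that assms by simp
  then show ?thesis
    unfolding avg_orders_def sum_permutations_of_set_snoc[OF assms]
    using k by (simp add: sum_divide_distrib[symmetric] field_simps)
qed

lemma avg_orders_add: "avg_orders S (\<lambda>xs. F xs + G xs) = avg_orders S F + avg_orders S G"
  by (simp add: avg_orders_def sum.distrib add_divide_distrib)

lemma avg_orders_mult: "avg_orders S (\<lambda>xs. F xs * c) = avg_orders S F * c"
  by (simp add: avg_orders_def sum_distrib_right)


lemma mset_map_permutation:
  "xs \<in> permutations_of_set S \<Longrightarrow> mset (map \<phi> xs) = image_mset \<phi> (mset_set S)"
  by (metis mset_map mset_set_set permutations_of_setD)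

lemma mset_map_permutation_snoc:
  assumes "finite S" "x \<in> S" "xs \<in> permutations_of_set (S - {x})"
  shows "mset (map \<phi> xs @ [\<phi> x]) = image_mset \<phi> (mset_set S)"
proof -
  have "mset (map \<phi> xs @ [\<phi> x]) = image_mset \<phi> (add_mset x (mset_set (S - {x})))"
    using mset_map_permutation[OF assms(3), of \<phi>] by simp
  also have "add_mset x (mset_set (S - {x})) = mset_set S"
    using assms by (simp add: mset_set.remove)
  finally show ?thesis .
qed

section \<open>Expected free capacity and expected packed value\<close>

text \<open>The solution computed on arrival of the last item \<open>x\<close> depends only on the
  multiset of \<open>S\<close>. The last factor is therefore the same for all orders of
  \<open>S - {x}\<close> and leaves the average.\<close>

lemma avg_orders_free_fraction_snoc:
  fixes v s :: "'a \<Rightarrow> real"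
  assumes "finite S" "x \<in> S" "m < card S"
  defines "\<phi> \<equiv> \<lambda>j. (v j, s j)"
  shows "avg_orders (S - {x}) (\<lambda>xs. free_fraction m C (map \<phi> xs @ [\<phi> x])) =
    avg_orders (S - {x}) (\<lambda>xs. free_fraction m C (map \<phi> xs)) *
      (1 - s x * opt_fraction C (image_mset \<phi> (mset_set S)) (\<phi> x) / C)"
  unfolding avg_orders_mult[symmetric]
proof (rule avg_orders_cong)
  fix xs assume xs: "xs \<in> permutations_of_set (S - {x})"
  have "m \<le> length (map \<phi> xs)"
    using assms xs by (simp add: length_finite_permutations_of_set)
  from free_fraction_snoc[OF this, of C "\<phi> x"]
  show "free_fraction m C (map \<phi> xs @ [\<phi> x]) = free_fraction m C (map \<phi> xs) *
      (1 - s x * opt_fraction C (image_mset \<phi> (mset_set S)) (\<phi> x) / C)"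
    unfolding mset_map_permutation_snoc[OF assms(1,2) xs] by (simp add: \<phi>_def)
qed

text \<open>The optimal fraction of \<open>x\<close> does not depend on the earlier order, so the
  gain from \<open>x\<close> is a constant times the free fraction.\<close>

lemma avg_orders_packed_snoc:
  fixes v s :: "'a \<Rightarrow> real"
  assumes "finite S" "x \<in> S" "m < card S"
  defines "\<phi> \<equiv> \<lambda>j. (v j, s j)"
  shows "avg_orders (S - {x}) (\<lambda>xs. packed fst m C (map \<phi> xs @ [\<phi> x])) =
    avg_orders (S - {x}) (\<lambda>xs. packed fst m C (map \<phi> xs)) +
    avg_orders (S - {x}) (\<lambda>xs. free_fraction m C (map \<phi> xs)) *
      (v x * opt_fraction C (image_mset \<phi> (mset_set S)) (\<phi> x))"
  unfolding avg_orders_mult[symmetric] avg_orders_add[symmetric]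
proof (rule avg_orders_cong)
  fix xs assume xs: "xs \<in> permutations_of_set (S - {x})"
  have "m \<le> length (map \<phi> xs)"
    using assms xs by (simp add: length_finite_permutations_of_set)
  then have "pack_last m C (map \<phi> xs @ [\<phi> x]) = free_fraction m C (map \<phi> xs) *
      opt_fraction C (image_mset \<phi> (mset_set S)) (\<phi> x)"
    unfolding pack_last_def mset_map_permutation_snoc[OF assms(1,2) xs] by simp
  then show "packed fst m C (map \<phi> xs @ [\<phi> x]) = packed fst m C (map \<phi> xs) +
      free_fraction m C (map \<phi> xs) *
        (v x * opt_fraction C (image_mset \<phi> (mset_set S)) (\<phi> x))"
    unfolding packed_snoc by (simp add: \<phi>_def)
qed

text \<open>Induction on \<open>card S\<close>, conditioning on the last item. The capacity shares
  of the items in the optimal solution on \<open>S\<close> sum to at most 1, so going from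
  \<open>k\<close> to \<open>k + 1\<close> items costs at most the factor
  \<open>k / (k + 1)\<close>. These factors telescope.\<close>

lemma avg_free_fraction_ge:
  fixes v s :: "'a \<Rightarrow> real"
  assumes "0 < C" "1 \<le> m" "finite S" "m \<le> card S"
  defines "\<phi> \<equiv> \<lambda>j. (v j, s j)"
  assumes "\<And>j. j \<in> S \<Longrightarrow> 0 \<le> s j"
  shows "m / card S \<le> avg_orders S (\<lambda>xs. free_fraction m C (map \<phi> xs))"
proof -
  obtain k where "m \<le> k" "card S = k"
    using assms by auto
  then show ?thesis
    using assms(3,6)
  proof (induction k arbitrary: S rule: dec_induct)
    case base
    then have "avg_orders S (\<lambda>xs. free_fraction m C (map \<phi> xs)) = avg_orders S (\<lambda>_. 1)"
      by (intro avg_orders_cong) (simp add: free_fraction_short length_finite_permutations_of_set)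
    then show ?case
      using base by (simp add: avg_orders_const)
  next
    case (step k)
    define a where "a x = s x * opt_fraction C (image_mset \<phi> (mset_set S)) (\<phi> x) / C" for x
    have k: "0 < k"
      using step assms(2) by simp
    \<comment> \<open>This makes \<open>1 - a x\<close> nonnegative, so that it can multiply the
      induction hypothesis.\<close>
    have a: "a x \<le> 1" if "x \<in> S" for x
      using used_fraction_bounds(2)[OF assms(1), of "image_mset \<phi> (mset_set S)" "\<phi> x"] step.prems that
      by (auto simp: a_def \<phi>_def)
    have "(\<Sum>x\<in>S. s x * opt_fraction C (image_mset \<phi> (mset_set S)) (\<phi> x)) \<le> C"
      using opt_fraction_size_le[of C "image_mset \<phi> (mset_set S)"] assms(1)
      unfolding sum_mset_image_mset_set by (simp add: \<phi>_def)
    then have sum_a: "(\<Sum>x\<in>S. a x) \<le> 1"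
      using assms(1) by (simp add: a_def sum_divide_distrib[symmetric])
    \<comment> \<open>The numerator \<open>k\<close> is \<open>Suc k - 1\<close>, and the 1 is then
      replaced by the smaller sum of all \<open>a x\<close>.\<close>
    have "m / card S = (m / k) * k / Suc k"
      using step k by simp
    also have "\<dots> \<le> (m / k) * (Suc k - (\<Sum>x\<in>S. a x)) / Suc k"
      using sum_a by (intro divide_right_mono mult_left_mono) auto
    also have "(m / k) * (Suc k - (\<Sum>x\<in>S. a x)) = (\<Sum>x\<in>S. (m / k) * (1 - a x))"
      unfolding sum_distrib_left[symmetric] using step.prems by (simp add: sum_subtractf)
    also have "\<dots> \<le> (\<Sum>x\<in>S. avg_orders (S - {x}) (\<lambda>xs. free_fraction m C (map \<phi> xs)) * (1 - a x))"
    proof (intro sum_mono mult_right_mono)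
      fix x assume x: "x \<in> S"
      then have "card (S - {x}) = k"
        using step.prems by simp
      then show "m / k \<le> avg_orders (S - {x}) (\<lambda>xs. free_fraction m C (map \<phi> xs))"
        using step.IH[of "S - {x}"] step.prems by auto
      show "0 \<le> 1 - a x"
        using a[OF x] by simp
    qed
    also have "\<dots> = (\<Sum>x\<in>S. avg_orders (S - {x}) (\<lambda>xs. free_fraction m C (map \<phi> (xs @ [x]))))"
      unfolding a_def \<phi>_def using step
      by (intro sum.cong refl) (subst avg_orders_free_fraction_snoc[symmetric], auto)
    also have "\<dots> / Suc k = avg_orders S (\<lambda>xs. free_fraction m C (map \<phi> xs))"
      using step.prems by (subst (2) avg_orders_snoc) auto
    finally show ?case
      by (simp add: divide_right_mono)
  qed
qed

text \<open>Induction on \<open>card S\<close>, conditioning on the last item. The comparison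
  solution \<open>y\<close> is any feasible one, since restricting an optimum to
  \<open>S - {x}\<close> preserves feasibility but not necessarily optimality.\<close>

lemma avg_packed_ge:
  fixes v s y :: "'a \<Rightarrow> real"
  assumes "0 < C" "1 \<le> m" "finite S" "m \<le> card S"
  defines "\<phi> \<equiv> \<lambda>j. (v j, s j)"
  assumes "\<And>j. j \<in> S \<Longrightarrow> 0 \<le> s j" "\<And>j. j \<in> S \<Longrightarrow> 0 \<le> v j" "\<And>j. j \<in> S \<Longrightarrow> y j \<in> {0..1}"
    "(\<Sum>j\<in>S. s j * y j) \<le> C"
  shows "m / card S * (\<Sum>i=m..<card S. 1 / i) * (\<Sum>j\<in>S. v j * y j)
    \<le> avg_orders S (\<lambda>xs. packed fst m C (map \<phi> xs))"
proof -
  obtain k where "m \<le> k" "card S = k"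
    using assms by auto
  then show ?thesis
    using assms(3,6-)
  proof (induction k arbitrary: S rule: dec_induct)
    case base
    then have "avg_orders S (\<lambda>xs. packed fst m C (map \<phi> xs)) = avg_orders S (\<lambda>_. 0)"
      by (intro avg_orders_cong) (simp add: packed_short length_finite_permutations_of_set)
    then show ?case
      using base by (simp add: avg_orders_const)
  next
    case (step k)
    define g where "g x = v x * opt_fraction C (image_mset \<phi> (mset_set S)) (\<phi> x)" for x
    define w where "w j = v j * y j" for j
    define H where "H = (\<Sum>i=m..<k. 1 / real i)"
    have k: "0 < k"
      using step assms(2) by simp
    have g: "0 \<le> g x" if "x \<in> S" for x
      using opt_fraction_bounds(1)[of C] step.prems that assms(1) by (simp add: g_def)
    have sum_g: "(\<Sum>x\<in>S. w x) \<le> (\<Sum>x\<in>S. g x)"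
      unfolding g_def w_def \<phi>_def using assms(1) step.prems by (intro opt_fraction_optimal) auto
    \<comment> \<open>Each \<open>j\<close> occurs in the inner sum for every \<open>x\<close> other
      than \<open>j\<close>, hence \<open>k\<close> times.\<close>
    have sum_w: "(\<Sum>x\<in>S. \<Sum>j\<in>S - {x}. w j) = k * (\<Sum>x\<in>S. w x)"
      using step.prems by (simp add: sum_diff1 sum_subtractf algebra_simps)
    \<comment> \<open>The first summand stands for the earlier rounds; the second, from the last
      round, supplies the new term \<open>1 / k\<close> of the harmonic sum.\<close>
    have "m / card S * (\<Sum>i=m..<card S. 1 / i) * (\<Sum>j\<in>S. w j)
        = (m / k * H * (k * (\<Sum>j\<in>S. w j)) + m / k * (\<Sum>j\<in>S. w j)) / Suc k"
      using step k by (simp add: H_def field_simps)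
    also have "\<dots> \<le> (m / k * H * (k * (\<Sum>j\<in>S. w j)) + m / k * (\<Sum>j\<in>S. g j)) / Suc k"
      using sum_g by (intro divide_right_mono add_left_mono mult_left_mono) auto
    also have "m / k * H * (k * (\<Sum>j\<in>S. w j)) + m / k * (\<Sum>j\<in>S. g j) =
        (\<Sum>x\<in>S. m / k * H * (\<Sum>j\<in>S - {x}. w j) + m / k * g x)"
      unfolding sum_w[symmetric] sum.distrib sum_distrib_left[symmetric] ..
    also have "\<dots> \<le> (\<Sum>x\<in>S. avg_orders (S - {x}) (\<lambda>xs. packed fst m C (map \<phi> xs)) +
        avg_orders (S - {x}) (\<lambda>xs. free_fraction m C (map \<phi> xs)) * g x)"
    proof (intro sum_mono add_mono mult_right_mono)
      fix x assume x: "x \<in> S"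
      then have card: "card (S - {x}) = k"
        using step.prems by simp
      \<comment> \<open>Dropping an item cannot increase the size, so \<open>y\<close> remains
        feasible for the induction hypothesis.\<close>
      have "(\<Sum>j\<in>S - {x}. s j * y j) \<le> (\<Sum>j\<in>S. s j * y j)"
        using x step.prems by (intro sum_mono2 mult_nonneg_nonneg) auto
      then have "(\<Sum>j\<in>S - {x}. s j * y j) \<le> C"
        using step.prems by linarith
      then show "m / k * H * (\<Sum>j\<in>S - {x}. w j) \<le> avg_orders (S - {x}) (\<lambda>xs. packed fst m C (map \<phi> xs))"
        using step.IH[of "S - {x}"] step.prems card by (auto simp: H_def w_def)
      show "m / k \<le> avg_orders (S - {x}) (\<lambda>xs. free_fraction m C (map \<phi> xs))"
        using avg_free_fraction_ge[OF assms(1,2), of "S - {x}" s v] step card by (auto simp: \<phi>_def)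
      show "0 \<le> g x"
        by (rule g[OF x])
    qed
    also have "\<dots> = (\<Sum>x\<in>S. avg_orders (S - {x}) (\<lambda>xs. packed fst m C (map \<phi> (xs @ [x]))))"
      unfolding g_def \<phi>_def using step
      by (intro sum.cong refl) (subst avg_orders_packed_snoc[symmetric], auto)
    also have "\<dots> / Suc k = avg_orders S (\<lambda>xs. packed fst m C (map \<phi> xs))"
      using step.prems by (subst (2) avg_orders_snoc) auto
    finally show ?case
      by (simp add: divide_right_mono w_def)
  qed
qed

section \<open>From averages over lists to the online model\<close>

text \<open>Outside \<open>{1..n}\<close> a permutation is the identity, so its list determines it.
  Surjectivity follows by counting.\<close>

lemma bij_betw_permutes_permutations_of_set:
  "bij_betw (\<lambda>\<pi>. map \<pi> [1..<Suc n]) {\<pi>. \<pi> permutes {1..n}} (permutations_of_set {1..n})"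
proof -
  let ?f = "\<lambda>\<pi>. map \<pi> [1..<Suc n]"
  have inj: "inj_on ?f {\<pi>. \<pi> permutes {1..n}}"
  proof (rule inj_onI, rule ext)
    fix \<pi> \<sigma> :: "nat \<Rightarrow> nat" and i
    assume "\<pi> \<in> {\<pi>. \<pi> permutes {1..n}}" "\<sigma> \<in> {\<pi>. \<pi> permutes {1..n}}" "?f \<pi> = ?f \<sigma>"
    then show "\<pi> i = \<sigma> i"
      by (cases "i \<in> {1..n}") (auto simp: permutes_not_in simp del: upt_Suc)
  qed
  moreover have "?f ` {\<pi>. \<pi> permutes {1..n}} \<subseteq> permutations_of_set {1..n}"
  proof (intro image_subsetI permutations_of_setI)
    fix \<pi> assume "\<pi> \<in> {\<pi>. \<pi> permutes {1..n}}"
    then have \<pi>: "\<pi> permutes {1..n}" by simp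
    have upt: "set [1..<Suc n] = {1..n}" by auto
    show "set (map \<pi> [1..<Suc n]) = {1..n}"
      unfolding set_map upt by (rule permutes_image[OF \<pi>])
    show "distinct (map \<pi> [1..<Suc n])"
      unfolding distinct_map by (auto intro: inj_on_subset[OF permutes_inj[OF \<pi>]] simp del: upt_Suc)
  qed
  moreover have "card (?f ` {\<pi>. \<pi> permutes {1..n}}) = card (permutations_of_set {1..n})"
    using inj by (simp add: card_image card_permutations[OF refl] del: upt_Suc)
  ultimately show ?thesis
    unfolding bij_betw_def by (simp add: card_subset_eq)
qed

text \<open>The share \<open>1 / exp 1\<close> maximises \<open>t * ln (1 / t)\<close>, the limiting
  guarantee when a share \<open>t\<close> of the items is skipped. Rounding up keeps the sample
  nonempty for \<open>0 < n\<close>.\<close>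

definition sample_size :: "nat \<Rightarrow> nat" where
  "sample_size n = nat \<lceil>real n / exp 1\<rceil>"

definition knapsack_alg :: "(nat \<Rightarrow> real) decision_rule" where
  "knapsack_alg n C r h = pack_last (sample_size n) C h"

definition trivial_seed :: "(nat \<Rightarrow> real) seed_dist" where
  "trivial_seed n C = return (count_space UNIV) (\<lambda>_. 0)"

text \<open>Reindexing by rounds, as item \<open>\<pi> l\<close> arrives in round \<open>l\<close>.
  The case \<open>w = snd\<close> serves feasibility, \<open>w = fst\<close> the value.\<close>

lemma sum_packing_knapsack_alg:
  assumes "\<pi> permutes {1..n}"
  shows "(\<Sum>j=1..n. w (v j, s j) * packing knapsack_alg n C v s \<pi> r j) =
    packed w (sample_size n) C (history v s \<pi> n)"
proof -
  have "(\<Sum>j=1..n. w (v j, s j) * packing knapsack_alg n C v s \<pi> r j) =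
      (\<Sum>l=1..n. w (v (\<pi> l), s (\<pi> l)) * packing knapsack_alg n C v s \<pi> r (\<pi> l))"
    by (rule sum.permute[OF assms, unfolded comp_def])
  also have "\<dots> = (\<Sum>l=1..n. w (v (\<pi> l), s (\<pi> l)) * pack_last (sample_size n) C (history v s \<pi> l))"
    by (simp add: packing_def knapsack_alg_def permutes_inverses(2)[OF assms])
  also have "\<dots> = (\<Sum>k<n. w (v (\<pi> (Suc k)), s (\<pi> (Suc k))) * pack_last (sample_size n) C (history v s \<pi> (Suc k)))"
    by (rule sum.reindex_bij_witness[of _ Suc "\<lambda>l. l - 1"]) auto
  also have "\<dots> = packed w (sample_size n) C (history v s \<pi> n)"
    by (auto simp: packed_def history_def take_map simp del: upt_Suc intro!: sum.cong)
  finally show ?thesis .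
qed

lemma knapsack_alg_feasible:
  assumes inst: "knapsack_instance n C v s" and \<pi>: "\<pi> permutes {1..n}"
  shows "feasible n C s (packing knapsack_alg n C v s \<pi> r)"
proof -
  have C: "0 < C" and s: "\<forall>j\<in>{1..n}. 0 < s j"
    using inst by (auto simp: knapsack_instance_def)
  have pos: "\<forall>q\<in>set (history v s \<pi> l). 0 \<le> snd q" if "l \<le> n" for l
    using that s permutes_in_image[OF \<pi>] by (auto simp: history_def less_imp_le simp del: upt_Suc)
  have "packing knapsack_alg n C v s \<pi> r j \<in> {0..1}" if "j \<in> {1..n}" for j
  proof -
    have "inv \<pi> j \<le> n"
      using permutes_in_image[OF permutes_inv[OF \<pi>], of j] that by simp
    then show ?thesis
      unfolding packing_def knapsack_alg_def by (intro pack_last_bounds C pos)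
  qed
  moreover have "(\<Sum>j=1..n. s j * packing knapsack_alg n C v s \<pi> r j) \<le> C"
    using sum_packing_knapsack_alg[OF \<pi>, of snd v s C r] C
      packed_size[of C "sample_size n" "history v s \<pi> n"]
      free_fraction_bounds(1)[OF C pos, of n "sample_size n"] by simp
  ultimately show ?thesis
    by (simp add: feasible_def)
qed

lemma prob_space_trivial_seed: "prob_space (trivial_seed n C)"
  unfolding trivial_seed_def by (rule prob_space_return) simp

text \<open>The rule ignores the seed, so the inner integral is that of a constant; the outer
  average moves from permutations to lists along the bijection.\<close>

lemma expected_value_knapsack_alg:
  "expected_value trivial_seed knapsack_alg n C v s =
    avg_orders {1..n} (\<lambda>xs. packed fst (sample_size n) C (map (\<lambda>j. (v j, s j)) xs))"
proof -
  interpret prob_space "trivial_seed n C" by (rule prob_space_trivial_seed)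
  let ?P = "{\<pi>. \<pi> permutes {1..n}}"
  have "(LINT r|trivial_seed n C. solution_value n v (packing knapsack_alg n C v s \<pi> r)) =
      packed fst (sample_size n) C (map (\<lambda>j. (v j, s j)) (map \<pi> [1..<Suc n]))" if "\<pi> \<in> ?P" for \<pi>
    using sum_packing_knapsack_alg[of \<pi> n fst v s C] that prob_space
    by (simp add: solution_value_def history_def comp_def del: upt_Suc)
  moreover have "finite ?P" "?P \<noteq> {}" "card ?P = fact n"
    by (simp add: finite_permutations, use permutes_id in blast)
       (simp add: card_permutations[OF refl] del: One_nat_def)
  ultimately have "expected_value trivial_seed knapsack_alg n C v s =
      (\<Sum>\<pi>\<in>?P. packed fst (sample_size n) C (map (\<lambda>j. (v j, s j)) (map \<pi> [1..<Suc n]))) / fact n"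
    unfolding expected_value_def by (simp add: integral_pmf_of_set del: upt_Suc map_map)
  also have "\<dots> = avg_orders {1..n} (\<lambda>xs. packed fst (sample_size n) C (map (\<lambda>j. (v j, s j)) xs))"
    unfolding avg_orders_def
      sum.reindex_bij_betw[OF bij_betw_permutes_permutations_of_set,
        where g = "\<lambda>xs. packed fst (sample_size n) C (map (\<lambda>j. (v j, s j)) xs)"]
    by simp
  finally show ?thesis .
qed

section \<open>Asymptotics of the guarantee\<close>

text \<open>Passing from \<open>n\<close> to \<open>n + 1\<close> adds \<open>ln (1 + 1 / n)\<close>
  on the left, which is at most the new term \<open>1 / n\<close>.\<close>

lemma ln_le_sum_inverse:
  assumes "1 \<le> m" "m \<le> n"
  shows "ln (n / m) \<le> (\<Sum>i=m..<n. 1 / real i)"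
  using assms(2)
proof (induction n rule: dec_induct)
  case base
  then show ?case using assms by simp
next
  case (step n)
  then have "0 < real n" "0 < real m"
    using assms by auto
  then have "ln (Suc n / m) = ln (n / m) + ln (1 + 1 / n)"
    by (simp add: ln_mult[symmetric] ln_div field_simps)
  also have "ln (1 + 1 / n) \<le> 1 / n"
    using \<open>0 < real n\<close> by (intro ln_add_one_self_le_self) simp
  finally show ?case
    using step by simp
qed

lemma sample_size_bounds:
  assumes "0 < n"
  shows "1 \<le> sample_size n" "sample_size n \<le> n"
proof -
  have "0 < real n / exp 1"
    using assms by simp
  then show "1 \<le> sample_size n"
    unfolding sample_size_def by linarith
  have "real n / exp 1 \<le> real n"
    by (simp add: divide_le_eq mult_le_cancel_left1)
  then show "sample_size n \<le> n"
    unfolding sample_size_def by (simp add: ceiling_le_iff)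
qed

definition competitive_error :: "nat \<Rightarrow> real" where
  "competitive_error n = 1 / exp 1 - sample_size n / n * ln (n / sample_size n)"

text \<open>Rounding changes the ratio \<open>sample_size n / n\<close> by at most
  \<open>1 / n\<close>, so it tends to \<open>1 / exp 1\<close>. The error is a function of this
  ratio, continuous and zero at \<open>1 / exp 1\<close>.\<close>

lemma competitive_error_smallo: "competitive_error \<in> o(\<lambda>_. 1)"
proof -
  have "(\<lambda>n. real (sample_size n) / n) \<longlonglongrightarrow> 1 / exp 1"
  proof (rule real_tendsto_sandwich)
    show "\<forall>\<^sub>F n in sequentially. 1 / exp 1 \<le> real (sample_size n) / n"
      using eventually_gt_at_top[of 0]
    proof eventually_elim
      case (elim n)
      have "real n / exp 1 \<le> sample_size n"
        unfolding sample_size_def by linarith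
      then show ?case
        using elim by (simp add: field_simps)
    qed
    show "\<forall>\<^sub>F n in sequentially. real (sample_size n) / n \<le> 1 / exp 1 + 1 / n"
      using eventually_gt_at_top[of 0]
    proof eventually_elim
      case (elim n)
      have "0 \<le> real n / exp 1" by simp
      then have "sample_size n \<le> real n / exp 1 + 1"
        unfolding sample_size_def by linarith
      then show ?case
        using elim by (simp add: field_simps)
    qed
  qed real_asymp+
  then have "(\<lambda>n. 1 / exp 1 - real (sample_size n) / n * ln (inverse (real (sample_size n) / n))) \<longlonglongrightarrow>
      1 / exp 1 - 1 / exp 1 * ln (inverse (1 / exp 1))" (is "?f \<longlonglongrightarrow> _")
    by (intro tendsto_diff tendsto_mult tendsto_ln tendsto_inverse tendsto_const) auto
  then have "competitive_error \<longlonglongrightarrow> 0"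
    by (simp add: competitive_error_def[abs_def])
  then show ?thesis
    by (intro smalloI_tendsto) auto
qed

theorem theorem4p1:
  "\<exists>(seed :: (nat \<Rightarrow> real) seed_dist) (A :: (nat \<Rightarrow> real) decision_rule).
     online_algorithm seed A \<and> competitive (1 / exp 1) seed A"
proof (intro exI conjI)
  show "online_algorithm trivial_seed knapsack_alg"
    unfolding online_algorithm_def
    using prob_space_trivial_seed knapsack_alg_feasible by (auto simp: knapsack_alg_def)
  have "(1 / exp 1 - competitive_error n) * solution_value n v x
      \<le> expected_value trivial_seed knapsack_alg n C v s"
    if inst: "knapsack_instance n C v s" and opt: "optimal n C v s x" for n C v s x
  \<comment> \<open>Without items both sides are 0; the bounds on \<open>sample_size n\<close>
    require \<open>0 < n\<close>.\<close>
  proof (cases "n = 0")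
    case True
    then show ?thesis
      by (simp add: expected_value_knapsack_alg solution_value_def avg_orders_def packed_def)
  next
    case False
    let ?m = "sample_size n"
    note m = sample_size_bounds[of n]
    have pos: "0 < C" "\<And>j. j \<in> {1..n} \<Longrightarrow> 0 \<le> s j" "\<And>j. j \<in> {1..n} \<Longrightarrow> 0 \<le> v j"
      using inst by (auto simp: knapsack_instance_def less_imp_le)
    have x: "x j \<in> {0..1}" if "j \<in> {1..n}" for j
      using opt that by (auto simp: optimal_def feasible_def)
    have "0 \<le> solution_value n v x"
      unfolding solution_value_def using pos x by (intro sum_nonneg mult_nonneg_nonneg) auto
    moreover have "?m / n * ln (n / ?m) \<le> ?m / n * (\<Sum>i=?m..<n. 1 / real i)"
      using m False by (intro mult_left_mono ln_le_sum_inverse) auto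
    ultimately have "(1 / exp 1 - competitive_error n) * solution_value n v x
        \<le> ?m / n * (\<Sum>i=?m..<n. 1 / real i) * solution_value n v x"
      by (intro mult_right_mono) (auto simp: competitive_error_def)
    \<comment> \<open>The optimum \<open>x\<close> is taken as the comparison solution
      \<open>y\<close> of \<open>avg_packed_ge\<close>.\<close>
    also have "\<dots> \<le> expected_value trivial_seed knapsack_alg n C v s"
      unfolding expected_value_knapsack_alg solution_value_def
      using avg_packed_ge[of C ?m "{1..n}" s v x] m False pos x opt
      by (simp add: optimal_def feasible_def)
    finally show ?thesis .
  qed
  then show "competitive (1 / exp 1) trivial_seed knapsack_alg"
    unfolding competitive_def using competitive_error_smallo by blast
qed

end
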